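(* Let $\Sigma_L=(M,L,Fe)$ be a Lagrangian mechanical system with energy $\mathcal E_L=y^i\frac{\partial L}{\partial y^i}-L$. The variation of the energy $\mathcal E_L$ along the evolution curves $t\mapsto x(t)$ of $\Sigma_L$ is given by $$\frac{d\mathcal E_L}{dt}=F_i\left(x,\frac{dx}{dt}\right)\frac{dx^i}{dt}.$$
   Context: The summation convention is used. $M$ is a real $n$-dimensional smooth manifold, $(x^i,y^i)$ are the induced coordinates on $TM$, and $\widetilde{TM}$ is $TM$ with the zero section removed. A Lagrange space $(M,L)$ is given by a function $L:TM\to\mathbb R$, smooth on $\widetilde{TM}$ and continuous on the zero section, such that $g_{ij}=\frac12\frac{\partial^2L}{\partial y^i\partial y^j}$ is nonsingular and of constant signature on $\widetilde{TM}$. A Lagrangian mechanical system is a triple $\Sigma_L=(M,L,Fe)$ with $(M,L)$ a Lagrange space and $Fe=F^i(x,y)\frac{\partial}{\partial y^i}$ a given vertical vector field on $TM$ (external forces), with covariant components $F_i=g_{ij}F^j$. The evolution curves of $\Sigma_L$ are the curves $x(t)$ (with extension $(x,\dot x)$ in $\widetilde{TM}$) satisfying the Lagrange equations $\frac{d}{dt}\frac{\partial L}{\partial y^i}-\frac{\partial L}{\partial x^i}=F_i(x,y)$, $y^i=\frac{dx^i}{dt}$. *)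

theory Defs
  imports "HOL-Analysis.Analysis"
begin

section \<open>Smooth maps and smooth manifolds\<close>

text \<open>Meant for open subsets of Euclidean spaces, where having continuous iterated
  directional derivatives up to order \<open>k\<close> is the same as being of class \<open>C\<^sup>k\<close>.\<close>

primrec Ck_on :: "nat \<Rightarrow> 'a::real_normed_vector set \<Rightarrow> ('a \<Rightarrow> 'b::real_normed_vector) \<Rightarrow> bool" where
  "Ck_on 0 S f \<longleftrightarrow> continuous_on S f"
| "Ck_on (Suc k) S f \<longleftrightarrow> (\<forall>x\<in>S. f differentiable at x) \<and>
     (\<forall>v. Ck_on k S (\<lambda>x. frechet_derivative f (at x) v))"

definition smooth_on :: "'a::real_normed_vector set \<Rightarrow> ('a \<Rightarrow> 'b::real_normed_vector) \<Rightarrow> bool" where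
  "smooth_on S f \<longleftrightarrow> (\<forall>k. Ck_on k S f)"

text \<open>A chart is a pair of its domain and its coordinate map; the values of the coordinate
  map outside the domain are irrelevant.\<close>

type_synonym ('m, 'e) chart = "'m set \<times> ('m \<Rightarrow> 'e)"

abbreviation dom_chart :: "('m, 'e) chart \<Rightarrow> 'm set" where
  "dom_chart c \<equiv> fst c"

abbreviation coords :: "('m, 'e) chart \<Rightarrow> 'm \<Rightarrow> 'e" where
  "coords c \<equiv> snd c"

abbreviation image_chart :: "('m, 'e) chart \<Rightarrow> 'e set" where
  "image_chart c \<equiv> coords c ` dom_chart c"

text \<open>The coordinate expression of \<open>f\<close> in the chart \<open>c\<close>, to be used on \<open>image_chart c\<close>.\<close>

definition in_chart :: "('m, 'e) chart \<Rightarrow> ('m \<Rightarrow> 'b) \<Rightarrow> 'e \<Rightarrow> 'b" where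
  "in_chart c f = (\<lambda>x. f (inv_into (dom_chart c) (coords c) x))"

definition transition :: "('m, 'e) chart \<Rightarrow> ('m, 'e) chart \<Rightarrow> 'e \<Rightarrow> 'e" where
  "transition c d = in_chart c (coords d)"

definition is_chart :: "'m topology \<Rightarrow> ('m, 'e::euclidean_space) chart \<Rightarrow> bool" where
  "is_chart M c \<longleftrightarrow> openin M (dom_chart c) \<and> open (image_chart c) \<and>
     homeomorphic_map (subtopology M (dom_chart c)) (top_of_set (image_chart c)) (coords c)"

text \<open>The atlas \<open>A\<close> need not be maximal. The dimension is that of the model space \<open>'e\<close>.\<close>

definition smooth_manifold :: "'m topology \<Rightarrow> ('m, 'e::euclidean_space) chart set \<Rightarrow> bool" where
  "smooth_manifold M A \<longleftrightarrow>
     Hausdorff_space M \<and> second_countable M \<and>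
     (\<forall>c\<in>A. is_chart M c) \<and> topspace M = (\<Union>c\<in>A. dom_chart c) \<and>
     (\<forall>c\<in>A. \<forall>d\<in>A. smooth_on (coords c ` (dom_chart c \<inter> dom_chart d)) (transition c d))"

section \<open>The tangent bundle\<close>

definition charts_at :: "('m, 'e) chart set \<Rightarrow> 'm \<Rightarrow> ('m, 'e) chart set" where
  "charts_at A p = {c \<in> A. p \<in> dom_chart c}"

text \<open>A tangent vector is given by its base point and its components in all charts around
  that point, which are related by the Jacobians of the chart transitions. The components
  at all other charts are \<open>0\<close> by convention.\<close>

type_synonym ('m, 'e) tvec = "'m \<times> (('m, 'e) chart \<Rightarrow> 'e)"

abbreviation base :: "('m, 'e) tvec \<Rightarrow> 'm" where
  "base w \<equiv> fst w"

abbreviation component :: "('m, 'e) tvec \<Rightarrow> ('m, 'e) chart \<Rightarrow> 'e" where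
  "component w c \<equiv> snd w c"

definition tangent_space ::
    "('m, 'e::euclidean_space) chart set \<Rightarrow> 'm \<Rightarrow> ('m, 'e) tvec set" where
  "tangent_space A p = {w. base w = p \<and>
     (\<forall>c\<in>charts_at A p. \<forall>d\<in>charts_at A p.
        component w d = frechet_derivative (transition c d) (at (coords c p)) (component w c)) \<and>
     (\<forall>c. c \<notin> charts_at A p \<longrightarrow> component w c = 0)}"

definition tangent_bundle :: "('m, 'e::euclidean_space) chart set \<Rightarrow> ('m, 'e) tvec set" where
  "tangent_bundle A = (\<Union>p\<in>(\<Union>c\<in>A. dom_chart c). tangent_space A p)"

text \<open>The tangent bundle with the zero section removed.\<close>

definition slit_tangent_bundle :: "('m, 'e::euclidean_space) chart set \<Rightarrow> ('m, 'e) tvec set" where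
  "slit_tangent_bundle A = {w \<in> tangent_bundle A. snd w \<noteq> (\<lambda>_. 0)}"

text \<open>The chart \<open>(x, y)\<close> of the tangent bundle induced by a chart \<open>x\<close>. Its image is
  \<open>image_chart c \<times> UNIV\<close>.\<close>

definition induced_chart ::
    "('m, 'e::euclidean_space) chart set \<Rightarrow> ('m, 'e) chart \<Rightarrow> (('m, 'e) tvec, 'e \<times> 'e) chart" where
  "induced_chart A c =
     ({w \<in> tangent_bundle A. base w \<in> dom_chart c}, \<lambda>w. (coords c (base w), component w c))"

definition tangent_atlas ::
    "('m, 'e::euclidean_space) chart set \<Rightarrow> (('m, 'e) tvec, 'e \<times> 'e) chart set" where
  "tangent_atlas A = induced_chart A ` A"

definition slit_image :: "('m, 'e::euclidean_space) chart \<Rightarrow> ('e \<times> 'e) set" where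
  "slit_image c = image_chart c \<times> (UNIV - {0})"

text \<open>The partial derivatives with respect to \<open>x\<^sup>i\<close> and \<open>y\<^sup>i\<close>.\<close>

definition partial_x :: "'n \<Rightarrow> ((real^'n) \<times> (real^'n) \<Rightarrow> real) \<Rightarrow> (real^'n) \<times> (real^'n) \<Rightarrow> real" where
  "partial_x i f z = frechet_derivative f (at z) (axis i 1, 0)"

definition partial_y :: "'n \<Rightarrow> ((real^'n) \<times> (real^'n) \<Rightarrow> real) \<Rightarrow> (real^'n) \<times> (real^'n) \<Rightarrow> real" where
  "partial_y i f z = frechet_derivative f (at z) (0, axis i 1)"

section \<open>Lagrange spaces\<close>

text \<open>The signature of a symmetric matrix: the maximal dimensions of subspaces on which the
  quadratic form is positive definite and negative definite, respectively.\<close>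

definition signature :: "real^'n^'n \<Rightarrow> nat \<times> nat" where
  "signature G =
     (Max {dim V | V. subspace V \<and> (\<forall>v\<in>V. v \<noteq> 0 \<longrightarrow> v \<bullet> (G *v v) > 0)},
      Max {dim V | V. subspace V \<and> (\<forall>v\<in>V. v \<noteq> 0 \<longrightarrow> v \<bullet> (G *v v) < 0)})"

definition metric ::
    "('m, real^'n) chart set \<Rightarrow> (('m, real^'n) tvec \<Rightarrow> real) \<Rightarrow> ('m, real^'n) chart
     \<Rightarrow> (real^'n) \<times> (real^'n) \<Rightarrow> real^'n^'n" where
  "metric A L c z =
     (\<chi> i j. 1/2 * partial_y i (partial_y j (in_chart (induced_chart A c) L)) z)"

definition lagrange_space ::
    "'m topology \<Rightarrow> ('m, real^'n) chart set \<Rightarrow> (('m, real^'n) tvec \<Rightarrow> real) \<Rightarrow> bool" where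
  "lagrange_space M A L \<longleftrightarrow> smooth_manifold M A \<and>
     (\<forall>c\<in>A. smooth_on (slit_image c) (in_chart (induced_chart A c) L)) \<and>
     (\<forall>c\<in>A. \<forall>x\<in>image_chart c. isCont (in_chart (induced_chart A c) L) (x, 0)) \<and>
     (\<forall>c\<in>A. \<forall>z\<in>slit_image c. det (metric A L c z) \<noteq> 0) \<and>
     (\<exists>s. \<forall>c\<in>A. \<forall>z\<in>slit_image c. signature (metric A L c z) = s)"

text \<open>The energy \<open>y\<^sup>i \<partial>L/\<partial>y\<^sup>i - L\<close>, first in the coordinates of a given chart and then as
  a function on the tangent bundle, computed in an arbitrary chart around the base point. The
  choice is immaterial, as shown in \<open>energy_eq_local_energy\<close> below.\<close>

definition local_energy ::
    "('m, real^'n) chart set \<Rightarrow> (('m, real^'n) tvec \<Rightarrow> real) \<Rightarrow> ('m, real^'n) chart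
     \<Rightarrow> (real^'n) \<times> (real^'n) \<Rightarrow> real" where
  "local_energy A L c z =
     (\<Sum>i\<in>UNIV. snd z $ i * partial_y i (in_chart (induced_chart A c) L) z)
     - in_chart (induced_chart A c) L z"

definition energy ::
    "('m, real^'n) chart set \<Rightarrow> (('m, real^'n) tvec \<Rightarrow> real) \<Rightarrow> ('m, real^'n) tvec \<Rightarrow> real" where
  "energy A L w =
     (let c = (SOME c. c \<in> charts_at A (base w))
      in local_energy A L c (coords (induced_chart A c) w))"

section \<open>Mechanical systems and their evolution curves\<close>

text \<open>A vector field on the tangent bundle takes values in the tangent spaces of the tangent
  bundle; it is vertical if in induced coordinates it has the form \<open>F\<^sup>i \<partial>/\<partial>y\<^sup>i\<close>.\<close>

type_synonym ('m, 'e) bundle_field = "('m, 'e) tvec \<Rightarrow> (('m, 'e) tvec, 'e \<times> 'e) tvec"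

definition contravariant_force ::
    "('m, 'e::euclidean_space) chart set \<Rightarrow> ('m, 'e) bundle_field \<Rightarrow> ('m, 'e) chart
     \<Rightarrow> 'e \<times> 'e \<Rightarrow> 'e" where
  "contravariant_force A X c =
     in_chart (induced_chart A c) (\<lambda>w. snd (component (X w) (induced_chart A c)))"

text \<open>The field is only required to be smooth where the Lagrangian is.\<close>

definition vertical_field ::
    "('m, 'e::euclidean_space) chart set \<Rightarrow> ('m, 'e) bundle_field \<Rightarrow> bool" where
  "vertical_field A X \<longleftrightarrow>
     (\<forall>w\<in>tangent_bundle A. X w \<in> tangent_space (tangent_atlas A) w \<and>
        (\<forall>c\<in>charts_at A (base w). fst (component (X w) (induced_chart A c)) = 0)) \<and>
     (\<forall>c\<in>A. smooth_on (slit_image c) (contravariant_force A X c))"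

definition lagrangian_mechanical_system ::
    "'m topology \<Rightarrow> ('m, real^'n) chart set \<Rightarrow> (('m, real^'n) tvec \<Rightarrow> real)
     \<Rightarrow> ('m, real^'n) bundle_field \<Rightarrow> bool" where
  "lagrangian_mechanical_system M A L X \<longleftrightarrow> lagrange_space M A L \<and> vertical_field A X"

definition covariant_force ::
    "('m, real^'n) chart set \<Rightarrow> (('m, real^'n) tvec \<Rightarrow> real) \<Rightarrow> ('m, real^'n) bundle_field
     \<Rightarrow> ('m, real^'n) chart \<Rightarrow> 'n \<Rightarrow> (real^'n) \<times> (real^'n) \<Rightarrow> real" where
  "covariant_force A L X c i z =
     (\<Sum>j\<in>UNIV. metric A L c z $ i $ j * contravariant_force A X c z $ j)"

text \<open>The extension \<open>(x, dx/dt)\<close> of a curve to the tangent bundle.\<close>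

definition velocity ::
    "('m, 'e::euclidean_space) chart set \<Rightarrow> (real \<Rightarrow> 'm) \<Rightarrow> real \<Rightarrow> ('m, 'e) tvec" where
  "velocity A \<gamma> t =
     (\<gamma> t, \<lambda>c. if c \<in> charts_at A (\<gamma> t) then vector_derivative (coords c \<circ> \<gamma>) (at t) else 0)"

text \<open>Curves are required to be twice differentiable only, which suffices for the Lagrange
  equations to make sense.\<close>

definition evolution_curve ::
    "'m topology \<Rightarrow> ('m, real^'n) chart set \<Rightarrow> (('m, real^'n) tvec \<Rightarrow> real)
     \<Rightarrow> ('m, real^'n) bundle_field \<Rightarrow> real set \<Rightarrow> (real \<Rightarrow> 'm) \<Rightarrow> bool" where
  "evolution_curve M A L X I \<gamma> \<longleftrightarrow>
     open I \<and> is_interval I \<and> continuous_map (top_of_set I) M \<gamma> \<and>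
     (\<forall>t\<in>I. \<forall>c\<in>charts_at A (\<gamma> t).
        (coords c \<circ> \<gamma>) differentiable at t \<and>
        (\<lambda>s. vector_derivative (coords c \<circ> \<gamma>) (at s)) differentiable at t) \<and>
     (\<forall>t\<in>I. velocity A \<gamma> t \<in> slit_tangent_bundle A) \<and>
     (\<forall>t\<in>I. \<forall>c\<in>charts_at A (\<gamma> t). \<forall>i.
        let L\<^sub>c = in_chart (induced_chart A c) L;
            xy = (\<lambda>s. coords (induced_chart A c) (velocity A \<gamma> s))
        in deriv (\<lambda>s. partial_y i L\<^sub>c (xy s)) t - partial_x i L\<^sub>c (xy t)
           = covariant_force A L X c i (xy t))"

section \<open>The energy does not depend on the chart\<close>

lemma differentiable_if_smooth_on:
  assumes "smooth_on S f" "x \<in> S"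
  shows "f differentiable at x"
  using assms(1)[unfolded smooth_on_def, rule_format, of 1] assms(2) by simp

lemma transition_differentiable:
  assumes "smooth_manifold M A" "c \<in> charts_at A p" "d \<in> charts_at A p"
  shows "transition c d differentiable at (coords c p)"
proof (rule differentiable_if_smooth_on)
  show "smooth_on (coords c ` (dom_chart c \<inter> dom_chart d)) (transition c d)"
    using assms unfolding smooth_manifold_def charts_at_def by blast
  show "coords c p \<in> coords c ` (dom_chart c \<inter> dom_chart d)"
    using assms unfolding charts_at_def by blast
qed

lemma transition_linear:
  assumes "smooth_manifold M A" "c \<in> charts_at A p" "d \<in> charts_at A p"
  shows "linear (frechet_derivative (transition c d) (at (coords c p)))"
  by (intro linear_frechet_derivative transition_differentiable[OF assms])

lemma inj_on_chart:
  assumes "smooth_manifold M A" "c \<in> A"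
  shows "inj_on (coords c) (dom_chart c)"
proof -
  have c: "is_chart M c" using assms unfolding smooth_manifold_def by blast
  then have "inj_on (coords c) (topspace (subtopology M (dom_chart c)))"
    unfolding is_chart_def by (blast dest: homeomorphic_imp_injective_map)
  moreover have "topspace (subtopology M (dom_chart c)) = dom_chart c"
    using c openin_subset unfolding is_chart_def by fastforce
  ultimately show ?thesis by simp
qed

lemma base_tangent: "w \<in> tangent_space A p \<Longrightarrow> base w = p"
  unfolding tangent_space_def by blast

lemma component_change:
  "w \<in> tangent_space A p \<Longrightarrow> c \<in> charts_at A p \<Longrightarrow> d \<in> charts_at A p \<Longrightarrow>
     component w d = frechet_derivative (transition c d) (at (coords c p)) (component w c)"
  unfolding tangent_space_def by blast

lemma component_outside:
  "w \<in> tangent_space A p \<Longrightarrow> c \<notin> charts_at A p \<Longrightarrow> component w c = 0"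
  unfolding tangent_space_def by blast

lemma tangent_bundle_iff:
  "w \<in> tangent_bundle A \<longleftrightarrow> (\<exists>c\<in>A. base w \<in> dom_chart c) \<and> w \<in> tangent_space A (base w)"
  unfolding tangent_bundle_def using base_tangent by fastforce

lemma inj_on_induced_chart:
  assumes "smooth_manifold M A" "c \<in> A"
  shows "inj_on (coords (induced_chart A c)) (dom_chart (induced_chart A c))"
proof (rule inj_onI)
  fix v w
  assume v: "v \<in> dom_chart (induced_chart A c)" and w: "w \<in> dom_chart (induced_chart A c)"
    and eq: "coords (induced_chart A c) v = coords (induced_chart A c) w"
  have base: "base v = base w"
    using v w eq inj_on_chart[OF assms] by (auto simp: induced_chart_def dest: inj_onD)
  have vp: "v \<in> tangent_space A (base v)" and wp: "w \<in> tangent_space A (base v)"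
    using v w base by (simp_all add: induced_chart_def tangent_bundle_iff)
  have c: "c \<in> charts_at A (base v)"
    using v assms(2) by (auto simp: induced_chart_def charts_at_def)
  have "component v d = component w d" for d
  proof (cases "d \<in> charts_at A (base v)")
    case True
    have "component v c = component w c" using eq by (simp add: induced_chart_def)
    then show ?thesis
      using component_change[OF vp c True] component_change[OF wp c True] by simp
  next
    case False
    then show ?thesis using component_outside[OF vp] component_outside[OF wp] by simp
  qed
  then show "v = w" using base by (simp add: prod_eq_iff fun_eq_iff)
qed

lemma in_induced_chart:
  assumes "smooth_manifold M A" "c \<in> charts_at A p" "w \<in> tangent_space A p"
  shows "in_chart (induced_chart A c) f (coords c p, component w c) = f w"
proof -
  have c: "c \<in> A" and p: "p \<in> dom_chart c" and b: "base w = p"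
    using assms(2) base_tangent[OF assms(3)] by (simp_all add: charts_at_def)
  have "w \<in> dom_chart (induced_chart A c)"
    using assms(3) c p b by (auto simp: induced_chart_def tangent_bundle_iff)
  from inv_into_f_f[OF inj_on_induced_chart[OF assms(1) c] this] b
  show ?thesis by (simp add: in_chart_def induced_chart_def)
qed

lemma scale_tangent:
  assumes "smooth_manifold M A" "w \<in> tangent_space A p"
  shows "(p, \<lambda>c. s *\<^sub>R component w c) \<in> tangent_space A p"
  unfolding tangent_space_def
proof (intro CollectI conjI ballI allI impI)
  fix c d assume c: "c \<in> charts_at A p" and d: "d \<in> charts_at A p"
  show "component (p, \<lambda>c. s *\<^sub>R component w c) d =
      frechet_derivative (transition c d) (at (coords c p))
        (component (p, \<lambda>c. s *\<^sub>R component w c) c)"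
    using component_change[OF assms(2) c d] linear_scale[OF transition_linear[OF assms(1) c d]]
    by simp
qed (use component_outside[OF assms(2)] in auto)

lemma component_nonzero:
  assumes "smooth_manifold M A" "w \<in> tangent_space A p" "snd w \<noteq> (\<lambda>_. 0)" "c \<in> charts_at A p"
  shows "component w c \<noteq> 0"
proof
  assume z: "component w c = 0"
  have "component w d = 0" for d
    using component_change[OF assms(2,4), of d] component_outside[OF assms(2), of d] z
      linear_0[OF transition_linear[OF assms(1,4), of d]]
    by (cases "d \<in> charts_at A p") simp_all
  then show False using assms(3) by auto
qed

lemma sum_partial_y:
  assumes "f differentiable at z"
  shows "(\<Sum>i\<in>UNIV. y $ i * partial_y i f z) = frechet_derivative f (at z) (0, y)"
proof -
  have lin: "linear (frechet_derivative f (at z))"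
    by (rule linear_frechet_derivative[OF assms])
  have "(0::real^'n, y) = (\<Sum>i\<in>UNIV. y $ i *\<^sub>R (0, axis i 1))"
    using basis_expansion[of y]
    by (simp add: prod_eq_iff fst_sum snd_sum scalar_mult_eq_scaleR)
  then have "frechet_derivative f (at z) (0, y) =
      frechet_derivative f (at z) (\<Sum>i\<in>UNIV. y $ i *\<^sub>R (0, axis i 1))"
    by (rule arg_cong)
  also have "\<dots> = (\<Sum>i\<in>UNIV. y $ i * partial_y i f z)"
    by (simp only: linear_sum[OF lin] linear_scale[OF lin] partial_y_def real_scaleR_def)
  finally show ?thesis by simp
qed

lemma local_energy_fiber_derivative:
  assumes "lagrange_space M A L" "c \<in> charts_at A p" "w \<in> tangent_space A p" "snd w \<noteq> (\<lambda>_. 0)"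
  shows "((\<lambda>s. L (p, \<lambda>d. s *\<^sub>R component w d)) has_real_derivative
           local_energy A L c (coords c p, component w c) + L w) (at 1)"
proof -
  have M: "smooth_manifold M A" using assms(1) by (simp add: lagrange_space_def)
  let ?f = "in_chart (induced_chart A c) L" and ?z = "(coords c p, component w c)"
  have "?z \<in> slit_image c"
    using component_nonzero[OF M assms(3,4,2)] assms(2)
    by (auto simp: slit_image_def charts_at_def)
  moreover have "smooth_on (slit_image c) ?f"
    using assms(1,2) by (simp add: lagrange_space_def charts_at_def)
  ultimately have diff: "?f differentiable at ?z"
    by (rule differentiable_if_smooth_on[rotated])
  then have D: "(?f has_derivative frechet_derivative ?f (at ?z))
      (at ((\<lambda>s. (coords c p, s *\<^sub>R component w c)) (1::real)))"
    by (simp add: frechet_derivative_works[symmetric])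
  have "((\<lambda>s. (coords c p, s *\<^sub>R component w c)) has_derivative
      (\<lambda>h. (0, h *\<^sub>R component w c))) (at (1::real))"
    by (auto intro!: derivative_eq_intros)
  from diff_chain_at[OF this D]
  have "((\<lambda>s. ?f (coords c p, s *\<^sub>R component w c)) has_derivative
      (\<lambda>h. frechet_derivative ?f (at ?z) (0, h *\<^sub>R component w c))) (at 1)"
    by (simp add: o_def)
  moreover have "frechet_derivative ?f (at ?z) (0, h *\<^sub>R component w c) =
      frechet_derivative ?f (at ?z) (0, component w c) * h" for h
    using linear_scale[OF linear_frechet_derivative[OF diff], of h "(0, component w c)"]
    by simp
  moreover have "?f (coords c p, s *\<^sub>R component w c) = L (p, \<lambda>d. s *\<^sub>R component w d)" for s
    using in_induced_chart[OF M assms(2) scale_tangent[OF M assms(3)]] by simp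
  ultimately have "((\<lambda>s. L (p, \<lambda>d. s *\<^sub>R component w d)) has_real_derivative
      frechet_derivative ?f (at ?z) (0, component w c)) (at 1)"
    by (simp add: has_field_derivative_def)
  then show ?thesis
    using in_induced_chart[OF M assms(2,3), of L]
    by (simp add: local_energy_def sum_partial_y[OF diff])
qed

lemma local_energy_unique:
  assumes "lagrange_space M A L" "c \<in> charts_at A p" "d \<in> charts_at A p" "w \<in> tangent_space A p"
  shows "local_energy A L c (coords c p, component w c) =
         local_energy A L d (coords d p, component w d)"
proof (cases "snd w = (\<lambda>_. 0)")
  case True
  have M: "smooth_manifold M A" using assms(1) by (simp add: lagrange_space_def)
  show ?thesis
    using in_induced_chart[OF M assms(2,4), of L] in_induced_chart[OF M assms(3,4), of L] True
    by (simp add: local_energy_def)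
next
  case False
  from DERIV_unique[OF local_energy_fiber_derivative[OF assms(1,2,4) this]
      local_energy_fiber_derivative[OF assms(1,3,4) this]]
  show ?thesis by simp
qed

lemma energy_eq_local_energy:
  assumes "lagrange_space M A L" "w \<in> tangent_bundle A" "c \<in> charts_at A (base w)"
  shows "energy A L w = local_energy A L c (coords (induced_chart A c) w)"
proof -
  have "w \<in> tangent_space A (base w)"
    using assms(2) by (simp add: tangent_bundle_iff)
  from local_energy_unique[OF assms(1) someI[of "\<lambda>c. c \<in> charts_at A (base w)", OF assms(3)]
      assms(3) this]
  show ?thesis by (simp add: energy_def induced_chart_def Let_def)
qed

end

theory Submission
  imports Defs
begin

text \<open>In an induced chart write \<open>p\<^sub>i = \<partial>L/\<partial>y\<^sup>i\<close>, so that the energy is \<open>y\<^sup>i p\<^sub>i - L\<close>. Along any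
  curve \<open>(x(t), y(t))\<close> with \<open>dx/dt = y\<close> the product and chain rules give
  \<open>dE/dt = (dy\<^sup>i/dt) p\<^sub>i + y\<^sup>i (dp\<^sub>i/dt) - (\<partial>L/\<partial>x\<^sup>i) y\<^sup>i - p\<^sub>i (dy\<^sup>i/dt)\<close>.
  The two terms with the acceleration cancel, which leaves the Lagrange expression
  \<open>dp\<^sub>i/dt - \<partial>L/\<partial>x\<^sup>i\<close> contracted with \<open>y\<^sup>i\<close> (\<open>energy_variation_second_order_curve\<close>). On an
  evolution curve this expression is \<open>F\<^sub>i\<close>.

  To transfer this to the manifold, fix a chart around the point \<open>\<gamma> t\<close>. By continuity the curve
  stays in its domain for times near \<open>t\<close> (\<open>eventually_in_chart\<close>), and there the intrinsic
  energy agrees with its expression in that fixed chart, since the latter is independent of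
  the chart. The chain rule applies because the velocity never vanishes, so that its
  coordinates stay where the Lagrangian is smooth.\<close>

lemma frechet_derivative_eq_sum_partials:
  fixes f :: "(real^'n) \<times> (real^'n) \<Rightarrow> real"
  assumes "f differentiable at z"
  shows "frechet_derivative f (at z) (u, v) =
    (\<Sum>i\<in>UNIV. u $ i * partial_x i f z) + (\<Sum>i\<in>UNIV. v $ i * partial_y i f z)"
proof -
  have lin: "linear (frechet_derivative f (at z))"
    by (rule linear_frechet_derivative[OF assms])
  have "(u, 0::real^'n) = (\<Sum>i\<in>UNIV. u $ i *\<^sub>R (axis i 1, 0))"
    using basis_expansion[of u]
    by (simp add: prod_eq_iff fst_sum snd_sum scalar_mult_eq_scaleR)
  then have "frechet_derivative f (at z) (u, 0) =
      frechet_derivative f (at z) (\<Sum>i\<in>UNIV. u $ i *\<^sub>R (axis i 1, 0))"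
    by (rule arg_cong)
  also have "\<dots> = (\<Sum>i\<in>UNIV. u $ i * partial_x i f z)"
    by (simp only: linear_sum[OF lin] linear_scale[OF lin] partial_x_def real_scaleR_def)
  finally have "frechet_derivative f (at z) (u, 0) = (\<Sum>i\<in>UNIV. u $ i * partial_x i f z)" .
  moreover have "frechet_derivative f (at z) (u, v) =
      frechet_derivative f (at z) (u, 0) + frechet_derivative f (at z) (0, v)"
    using linear_add[OF lin, of "(u, 0)" "(0, v)"] by simp
  ultimately show ?thesis
    using sum_partial_y[OF assms] by simp
qed

lemma smooth_on_frechet_derivative:
  assumes "smooth_on S f"
  shows "smooth_on S (\<lambda>x. frechet_derivative f (at x) v)"
  unfolding smooth_on_def
proof
  fix k
  have "Ck_on (Suc k) S f"
    using assms unfolding smooth_on_def by blast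
  then show "Ck_on k S (\<lambda>x. frechet_derivative f (at x) v)" by simp
qed

lemma differentiable_partial_y:
  assumes "smooth_on S f" "z \<in> S"
  shows "partial_y i f differentiable at z"
  using differentiable_if_smooth_on[OF smooth_on_frechet_derivative[OF assms(1)] assms(2)]
  by (simp add: partial_y_def[abs_def])

text \<open>Differentiating \<open>y\<^sup>i p\<^sub>i\<close> produces the term \<open>a\<^sup>i p\<^sub>i\<close>, and differentiating \<open>f\<close> along the curve
  produces the same term, because \<open>p\<^sub>i\<close> is the fibre derivative of \<open>f\<close>; hence the acceleration
  \<open>a\<close> cancels. This is a kinematic identity: the dynamics enter only when the Lagrange
  expression on the right is replaced by the force.\<close>

lemma energy_variation_second_order_curve:
  fixes f :: "(real^'n) \<times> (real^'n) \<Rightarrow> real"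
  assumes f: "f differentiable at (z t)"
    and p: "\<And>i. partial_y i f differentiable at (z t)"
    and z: "(z has_vector_derivative (snd (z t), a)) (at t)"
  shows "((\<lambda>s. (\<Sum>i\<in>UNIV. snd (z s) $ i * partial_y i f (z s)) - f (z s)) has_real_derivative
           (\<Sum>i\<in>UNIV. (deriv (\<lambda>s. partial_y i f (z s)) t - partial_x i f (z t)) * snd (z t) $ i))
         (at t)"
proof -
  have z': "(z has_derivative (\<lambda>h. h *\<^sub>R (snd (z t), a))) (at t)"
    using z by (simp add: has_vector_derivative_def)
  have y: "((\<lambda>s. snd (z s) $ i) has_real_derivative a $ i) (at t)" for i
  proof -
    have "((\<lambda>s. snd (z s) $ i) has_derivative (\<lambda>h. snd (h *\<^sub>R (snd (z t), a)) $ i)) (at t)"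
      using bounded_linear.has_derivative[OF bounded_linear_vec_nth
          bounded_linear.has_derivative[OF bounded_linear_snd z']] by simp
    moreover have "(\<lambda>h. snd (h *\<^sub>R (snd (z t), a)) $ i) = (*) (a $ i)"
      by (auto simp: fun_eq_iff)
    ultimately show ?thesis by (simp add: has_field_derivative_def)
  qed
  have fz: "((\<lambda>s. f (z s)) has_real_derivative
      (\<Sum>i\<in>UNIV. snd (z t) $ i * partial_x i f (z t)) + (\<Sum>i\<in>UNIV. a $ i * partial_y i f (z t)))
      (at t)"
  proof -
    let ?D = "frechet_derivative f (at (z t))"
    have "((\<lambda>s. f (z s)) has_derivative (\<lambda>h. ?D (h *\<^sub>R (snd (z t), a)))) (at t)"
      using diff_chain_at[OF z' frechet_derivative_works[THEN iffD1, OF f]] by (simp add: o_def)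
    moreover have "(\<lambda>h. ?D (h *\<^sub>R (snd (z t), a))) = (*) (?D (snd (z t), a))"
      by (simp add: fun_eq_iff linear_scale[OF linear_frechet_derivative[OF f]] mult.commute
          del: scaleR_Pair)
    ultimately show ?thesis
      by (simp add: has_field_derivative_def frechet_derivative_eq_sum_partials[OF f])
  qed
  have pz: "((\<lambda>s. partial_y i f (z s)) has_real_derivative deriv (\<lambda>s. partial_y i f (z s)) t)
      (at t)" for i
  proof -
    have "(\<lambda>s. partial_y i f (z s)) differentiable at t"
      using differentiable_chain_at[OF differentiableI[OF z'] p[of i]] by (simp add: o_def)
    then show ?thesis by (simp add: DERIV_deriv_iff_real_differentiable)
  qed
  have "((\<lambda>s. (\<Sum>i\<in>UNIV. snd (z s) $ i * partial_y i f (z s)) - f (z s)) has_real_derivative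
      (\<Sum>i\<in>UNIV. a $ i * partial_y i f (z t) + deriv (\<lambda>s. partial_y i f (z s)) t * snd (z t) $ i)
      - ((\<Sum>i\<in>UNIV. snd (z t) $ i * partial_x i f (z t)) + (\<Sum>i\<in>UNIV. a $ i * partial_y i f (z t))))
      (at t)"
    by (intro DERIV_diff DERIV_sum DERIV_mult y pz fz)
  then show ?thesis
    by (rule DERIV_cong) (simp add: sum.distrib sum_subtractf algebra_simps)
qed

lemma eventually_in_chart:
  assumes "smooth_manifold M A" "open I" "continuous_map (top_of_set I) M \<gamma>"
    and "t \<in> I" "c \<in> charts_at A (\<gamma> t)"
  shows "\<forall>\<^sub>F s in nhds t. s \<in> I \<and> c \<in> charts_at A (\<gamma> s)"
proof -
  have c: "c \<in> A" "\<gamma> t \<in> dom_chart c"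
    using assms(5) by (simp_all add: charts_at_def)
  have "openin M (dom_chart c)"
    using assms(1) c(1) by (simp add: smooth_manifold_def is_chart_def)
  from openin_continuous_map_preimage[OF assms(3) this]
  have "open {s \<in> I. \<gamma> s \<in> dom_chart c}"
    using assms(2) by (simp add: openin_open_eq)
  from eventually_nhds_in_open[OF this, of t] show ?thesis
    using c assms(4) by (simp add: charts_at_def)
qed

text \<open>The lift of a curve by its velocities satisfies \<open>dx/dt = y\<close> in the chart \<open>c\<close>. The chart
  must contain the curve for all times near \<open>t\<close>, because \<open>velocity\<close> has component \<open>0\<close> in \<open>c\<close>
  whenever the curve is outside its domain.\<close>

lemma velocity_has_vector_derivative:
  assumes "\<forall>\<^sub>F s in nhds t. c \<in> charts_at A (\<gamma> s)"
    and x: "(coords c \<circ> \<gamma>) differentiable at t"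
    and y: "(\<lambda>s. vector_derivative (coords c \<circ> \<gamma>) (at s)) differentiable at t"
  obtains a where "((\<lambda>s. coords (induced_chart A c) (velocity A \<gamma> s)) has_vector_derivative
    (snd (coords (induced_chart A c) (velocity A \<gamma> t)), a)) (at t)"
proof -
  let ?y = "\<lambda>s. vector_derivative (coords c \<circ> \<gamma>) (at s)"
  let ?z = "\<lambda>s. coords (induced_chart A c) (velocity A \<gamma> s)"
  have eq: "\<forall>\<^sub>F s in nhds t. ((coords c \<circ> \<gamma>) s, ?y s) = ?z s"
    using assms(1) by eventually_elim (simp add: induced_chart_def velocity_def)
  have t: "((coords c \<circ> \<gamma>) t, ?y t) = ?z t"
    using eq by (rule eventually_nhds_x_imp_x)
  have "((\<lambda>s. ((coords c \<circ> \<gamma>) s, ?y s)) has_vector_derivative (?y t, vector_derivative ?y (at t)))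
      (at t)"
    using x y by (intro has_vector_derivative_Pair) (simp_all only: vector_derivative_works)
  moreover have "((\<lambda>s. ((coords c \<circ> \<gamma>) s, ?y s)) has_vector_derivative d) (at t) =
      (?z has_vector_derivative d) (at t)" for d
  proof (rule has_vector_derivative_cong_ev)
    show "\<forall>\<^sub>F s in nhds t. s \<in> UNIV \<longrightarrow> ((coords c \<circ> \<gamma>) s, ?y s) = ?z s"
      using eq by (rule eventually_mono) (rule impI)
  qed (fact t)
  ultimately have "(?z has_vector_derivative (?y t, vector_derivative ?y (at t))) (at t)"
    by (rule iffD1[rotated])
  moreover have "?y t = snd (?z t)"
    using t by (metis snd_conv)
  ultimately show thesis
    using that by simp
qed

theorem theorem3p3p3:
  fixes M :: "'m topology"
    and A :: "('m, real^'n) chart set"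
    and L :: "('m, real^'n) tvec \<Rightarrow> real"
    and Fe :: "('m, real^'n) bundle_field"
    and \<gamma> :: "real \<Rightarrow> 'm"
  assumes "lagrangian_mechanical_system M A L Fe"
    and "evolution_curve M A L Fe I \<gamma>"
    and "t \<in> I"
    and "c \<in> charts_at A (\<gamma> t)"
  shows "((\<lambda>s. energy A L (velocity A \<gamma> s)) has_real_derivative
           (\<Sum>i\<in>UNIV. covariant_force A L Fe c i (coords (induced_chart A c) (velocity A \<gamma> t))
              * vector_derivative (coords c \<circ> \<gamma>) (at t) $ i)) (at t)"
proof -
  let ?L = "in_chart (induced_chart A c) L"
  let ?z = "\<lambda>s. coords (induced_chart A c) (velocity A \<gamma> s)"
  have LS: "lagrange_space M A L"
    using assms(1) by (simp add: lagrangian_mechanical_system_def)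
  then have M: "smooth_manifold M A"
    by (simp add: lagrange_space_def)
  have cA: "c \<in> A" and ct: "\<gamma> t \<in> dom_chart c"
    using assms(4) by (simp_all add: charts_at_def)
  have slit: "velocity A \<gamma> s \<in> slit_tangent_bundle A" if "s \<in> I" for s
    using assms(2) that by (simp add: evolution_curve_def)
  have near: "\<forall>\<^sub>F s in nhds t. s \<in> I \<and> c \<in> charts_at A (\<gamma> s)"
    using assms(2-4) by (intro eventually_in_chart[OF M]) (simp_all add: evolution_curve_def)

  have zt: "?z t = (coords c (\<gamma> t), component (velocity A \<gamma> t) c)"
    by (simp add: induced_chart_def velocity_def)
  have "component (velocity A \<gamma> t) c \<noteq> 0"
  proof (rule component_nonzero[OF M _ _ assms(4)])
    show "velocity A \<gamma> t \<in> tangent_space A (\<gamma> t)" "snd (velocity A \<gamma> t) \<noteq> (\<lambda>_. 0)"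
      using slit[OF assms(3)]
      by (simp_all add: slit_tangent_bundle_def tangent_bundle_iff) (simp add: velocity_def)
  qed
  then have mem: "?z t \<in> slit_image c"
    using ct zt by (simp add: slit_image_def)
  have smooth: "smooth_on (slit_image c) ?L"
    using LS cA by (simp add: lagrange_space_def)

  obtain a where "(?z has_vector_derivative (snd (?z t), a)) (at t)"
  proof (rule velocity_has_vector_derivative[of c A \<gamma> t])
    show "\<forall>\<^sub>F s in nhds t. c \<in> charts_at A (\<gamma> s)"
      using near by (rule eventually_mono) simp
    show "(coords c \<circ> \<gamma>) differentiable at t"
      "(\<lambda>s. vector_derivative (coords c \<circ> \<gamma>) (at s)) differentiable at t"
      using assms(2-4) unfolding evolution_curve_def by blast+
  qed
  from energy_variation_second_order_curve[OF differentiable_if_smooth_on[OF smooth mem]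
      differentiable_partial_y[OF smooth mem] this]
  have deriv: "((\<lambda>s. local_energy A L c (?z s)) has_real_derivative
      (\<Sum>i\<in>UNIV. (deriv (\<lambda>s. partial_y i ?L (?z s)) t - partial_x i ?L (?z t)) * snd (?z t) $ i))
      (at t)"
    by (simp add: local_energy_def)

  have lagrange: "deriv (\<lambda>s. partial_y i ?L (?z s)) t - partial_x i ?L (?z t) =
      covariant_force A L Fe c i (?z t)" for i
    using assms(2-4) unfolding evolution_curve_def Let_def by blast
  have y: "snd (?z t) = vector_derivative (coords c \<circ> \<gamma>) (at t)"
    using assms(4) by (simp add: induced_chart_def velocity_def)
  have energy: "\<forall>\<^sub>F s in nhds t. energy A L (velocity A \<gamma> s) = local_energy A L c (?z s)"
    using near
  proof eventually_elim
    case (elim s)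
    then show ?case
      using slit[of s]
      by (intro energy_eq_local_energy[OF LS]) (simp_all add: slit_tangent_bundle_def velocity_def)
  qed
  from deriv show ?thesis
    unfolding lagrange y DERIV_cong_ev[OF refl energy refl] .
qed

end
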